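(* Suppose the following statement (A) holds. (A) For every positive integer $n$, every matroid $M$ of rank $n$ on $3n$ elements whose ground set is a disjoint union of $3$ bases of $M$, and all pairwise disjoint independent sets $I_1, I_2, \ldots, I_n$ of $M$ with $0 \le |I_i| \le 3$ for all $i$, there exists an $n\times 3$ grid $G$ containing each element of $M$ exactly once, such that for every $i$ the elements of $I_i$ appear in the $i$th row of $G$, and such that every column of $G$ is a basis of $M$. Then the following statement (B) (Rota's basis conjecture) holds. (B) For every positive integer $n$ and every matroid $M$ of rank $n$ on $n^2$ elements whose ground set is a disjoint union of $n$ bases $B_1, B_2, \ldots, B_n$ of $M$, there exists an $n\times n$ grid $G$ containing each element of $M$ exactly once, such that for every $i$ the elements of $B_i$ appear in the $i$th row of $G$, and such that every column of $G$ is a basis of $M$.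
   Context: An $n\times k$ grid (with $n$ rows and $k$ columns) containing each element of $M$ exactly once is a bijection from $\{1,\ldots,n\}\times\{1,\ldots,k\}$ to the ground set of $M$ (which has $nk$ elements); its $i$th row is the image of $\{i\}\times\{1,\ldots,k\}$ and its $j$th column is the image of $\{1,\ldots,n\}\times\{j\}$. "The elements of $I_i$ appear in the $i$th row" means that $I_i$ is contained in the $i$th row; the sets $I_i$ may be empty and need not cover the ground set. *)

theory Defs
  imports Main "HOL-Library.Disjoint_Sets"
begin

locale matroid =
  fixes E :: "'a set" and indep :: "'a set \<Rightarrow> bool"
  assumes finite_ground: "finite E"
    and indep_subset_ground: "indep X \<Longrightarrow> X \<subseteq> E"
    and indep_empty: "indep {}"
    and indep_subset: "indep X \<Longrightarrow> Y \<subseteq> X \<Longrightarrow> indep Y"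
    and augmentation: "indep X \<Longrightarrow> indep Y \<Longrightarrow> card X < card Y \<Longrightarrow> \<exists>y\<in>Y - X. indep (insert y X)"
begin

definition basis :: "'a set \<Rightarrow> bool" where
  "basis B \<longleftrightarrow> indep B \<and> (\<forall>x\<in>E - B. \<not> indep (insert x B))"

definition rank :: nat where
  "rank = Max (card ` {X. X \<subseteq> E \<and> indep X})"

end

text \<open>Only the values of \<open>G\<close> on the index set \<open>{1..n} \<times> {1..k}\<close> matter;
  rows and columns are indexed from 1.\<close>

definition is_grid :: "nat \<Rightarrow> nat \<Rightarrow> 'a set \<Rightarrow> (nat \<times> nat \<Rightarrow> 'a) \<Rightarrow> bool" where
  "is_grid n k E G \<longleftrightarrow> bij_betw G ({1..n} \<times> {1..k}) E"

definition grid_row :: "nat \<Rightarrow> (nat \<times> nat \<Rightarrow> 'a) \<Rightarrow> nat \<Rightarrow> 'a set" where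
  "grid_row k G i = G ` ({i} \<times> {1..k})"

definition grid_col :: "nat \<Rightarrow> (nat \<times> nat \<Rightarrow> 'a) \<Rightarrow> nat \<Rightarrow> 'a set" where
  "grid_col n G j = G ` ({1..n} \<times> {j})"

text \<open>Statement (A) for the matroids whose elements have type \<open>'a\<close>. A formula cannot
  quantify over types, hence the type argument. A matroid here is finite, so up to
  isomorphism every matroid has its elements in any given infinite type, for instance \<open>nat\<close>.\<close>

definition three_bases_statement :: "'a itself \<Rightarrow> bool" where
  "three_bases_statement _ \<longleftrightarrow>
    (\<forall>(n::nat) (E::'a set) indep (I :: nat \<Rightarrow> 'a set).
      n \<ge> 1 \<longrightarrow> matroid E indep \<longrightarrow> matroid.rank E indep = n \<longrightarrow> card E = 3 * n \<longrightarrow>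
      (\<exists>B :: nat \<Rightarrow> 'a set. (\<forall>j\<in>{1..3}. matroid.basis E indep (B j)) \<and>
         disjoint_family_on B {1..3} \<and> (\<Union>j\<in>{1..3}. B j) = E) \<longrightarrow>
      (\<forall>i\<in>{1..n}. indep (I i) \<and> card (I i) \<le> 3) \<longrightarrow>
      disjoint_family_on I {1..n} \<longrightarrow>
      (\<exists>G. is_grid n 3 E G \<and>
         (\<forall>i\<in>{1..n}. I i \<subseteq> grid_row 3 G i) \<and>
         (\<forall>j\<in>{1..3}. matroid.basis E indep (grid_col n G j))))"

definition rota_basis_conjecture :: "'a itself \<Rightarrow> bool" where
  "rota_basis_conjecture _ \<longleftrightarrow>
    (\<forall>(n::nat) (E::'a set) indep (B :: nat \<Rightarrow> 'a set).
      n \<ge> 1 \<longrightarrow> matroid E indep \<longrightarrow> matroid.rank E indep = n \<longrightarrow> card E = n ^ 2 \<longrightarrow>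
      (\<forall>i\<in>{1..n}. matroid.basis E indep (B i)) \<longrightarrow>
      disjoint_family_on B {1..n} \<longrightarrow> (\<Union>i\<in>{1..n}. B i) = E \<longrightarrow>
      (\<exists>G. is_grid n n E G \<and>
         (\<forall>i\<in>{1..n}. B i \<subseteq> grid_row n G i) \<and>
         (\<forall>j\<in>{1..n}. matroid.basis E indep (grid_col n G j))))"

end

theory Submission
  imports Defs
begin

text \<open>Among all partitions of the ground set into \<open>n\<close> bases (the columns), take one that maximizes
  the number of pairs (column, \<open>B i\<close>) that meet. If some column misses some \<open>B i\<close>, another column
  contains two elements of \<open>B i\<close>. Apply (A) to these two columns and a third one, choosing as \<open>I i\<close>
  a set of \<open>min 3 \<bar>B i \<inter> D\<bar>\<close> elements of \<open>B i\<close> in their union \<open>D\<close>. The three new columns meet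
  every \<open>B i\<close> as often as is possible, which contradicts maximality. Hence every column meets
  every \<open>B i\<close>, and the grid can be read off. This needs \<open>n \<ge> 3\<close>;
  for \<open>n = 2\<close> one of the two ways of pairing the elements of the bases works.\<close>

context matroid
begin

section \<open>Rank and bases in terms of cardinality\<close>

lemma indep_finite: "indep X \<Longrightarrow> finite X"
  using finite_ground indep_subset_ground finite_subset by blast

lemma indep_card_le_rank:
  assumes "indep X"
  shows "card X \<le> rank"
  unfolding rank_def
  using assms finite_ground indep_subset_ground by (intro Max_ge) auto

lemma indep_card_eq_rank: "\<exists>X. indep X \<and> card X = rank"
proof -
  have "rank \<in> card ` {X. X \<subseteq> E \<and> indep X}"
    unfolding rank_def using finite_ground indep_empty by (intro Max_in) auto
  then show ?thesis by auto
qed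

text \<open>A maximal independent set smaller than \<open>rank\<close> could be augmented from an
  independent set of size \<open>rank\<close>. Below, new bases are recognised by this size
  criterion.\<close>

lemma basis_iff_card: "basis X \<longleftrightarrow> indep X \<and> card X = rank"
proof
  assume b: "basis X"
  obtain Y where Y: "indep Y" "card Y = rank" using indep_card_eq_rank by auto
  have "\<not> card X < card Y"
    using b Y augmentation[of X Y] indep_subset_ground unfolding basis_def by blast
  then show "indep X \<and> card X = rank"
    using b Y indep_card_le_rank[of X] unfolding basis_def by auto
next
  assume X: "indep X \<and> card X = rank"
  have "\<not> indep (insert x X)" if "x \<notin> X" for x
    using indep_card_le_rank[of "insert x X"] X that indep_finite by auto
  then show "basis X" using X unfolding basis_def by auto
qed

lemma basis_subset_ground: "basis X \<Longrightarrow> X \<subseteq> E"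
  using indep_subset_ground unfolding basis_def by auto

section \<open>Statement (A) inside a larger matroid over an arbitrary element type\<close>

text \<open>Restriction to \<open>D\<close> and relabelling by \<open>f\<close> in one step: since
  \<open>f\<close> is injective on \<open>D\<close>, each axiom can be pulled back to subsets of
  \<open>D\<close>. This turns part of a matroid over any type into one over \<open>nat\<close>,
  where (A) is available.\<close>

lemma matroid_restrict_image:
  assumes f: "inj_on f D" and D: "D \<subseteq> E"
  shows "matroid (f ` D) (\<lambda>X. \<exists>Y\<subseteq>D. indep Y \<and> X = f ` Y)"
proof
  show "finite (f ` D)" using D finite_ground finite_subset by blast
next
  fix X Y assume "\<exists>Z\<subseteq>D. indep Z \<and> X = f ` Z" "Y \<subseteq> X"
  then obtain Z where Z: "Z \<subseteq> D" "indep Z" "Y \<subseteq> f ` Z" by auto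
  then obtain W where W: "W \<subseteq> Z" "Y = f ` W" by (auto simp: subset_image_iff)
  then have "W \<subseteq> D" "indep W" using Z indep_subset by auto
  then show "\<exists>W\<subseteq>D. indep W \<and> Y = f ` W" using W by auto
next
  fix X Y
  assume "\<exists>X'\<subseteq>D. indep X' \<and> X = f ` X'" "\<exists>Y'\<subseteq>D. indep Y' \<and> Y = f ` Y'"
    and c: "card X < card Y"
  then obtain X' Y' where *: "X' \<subseteq> D" "indep X'" "X = f ` X'" "Y' \<subseteq> D" "indep Y'" "Y = f ` Y'"
    by auto
  then have "card X' < card Y'" using c f by (metis card_image inj_on_subset)
  then obtain y where y: "y \<in> Y' - X'" "indep (insert y X')" using augmentation * by blast
  then have "f y \<in> Y - X" using * f by (auto dest: inj_onD)
  moreover have "insert (f y) X = f ` insert y X'" "insert y X' \<subseteq> D" using * y by auto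
  ultimately show "\<exists>y\<in>Y - X. \<exists>Z\<subseteq>D. indep Z \<and> insert y X = f ` Z" using y by metis
qed (auto simp: indep_empty)

text \<open>The matroid is restricted to the union of the three bases, which is finite and hence can
  be numbered injectively. Then (A) is applied over \<open>nat\<close>, and the resulting grid is
  composed with the inverse of the numbering.\<close>

lemma three_bases_grid:
  fixes C I :: "nat \<Rightarrow> 'a set"
  assumes A: "three_bases_statement TYPE(nat)"
    and rank: "rank \<ge> 1"
    and C: "\<And>j. j \<in> {1..3} \<Longrightarrow> basis (C j)" "disjoint_family_on C {1..3}"
    and I: "\<And>i. i \<in> {1..rank} \<Longrightarrow> indep (I i) \<and> card (I i) \<le> 3 \<and> I i \<subseteq> (\<Union>j\<in>{1..3}. C j)"
      "disjoint_family_on I {1..rank}"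
  obtains G where "is_grid rank 3 (\<Union>j\<in>{1..3}. C j) G"
    "\<And>i. i \<in> {1..rank} \<Longrightarrow> I i \<subseteq> grid_row 3 G i"
    "\<And>j. j \<in> {1..3} \<Longrightarrow> basis (grid_col rank G j)"
proof -
  define D where "D = (\<Union>j\<in>{1..3}. C j)"
  have DE: "D \<subseteq> E" unfolding D_def using C basis_subset_ground by blast
  then have "finite D" using finite_ground finite_subset by blast
  then obtain f :: "'a \<Rightarrow> nat" where f: "inj_on f D"
    using finite_imp_inj_to_nat_seg by blast
  define indep' where "indep' X \<longleftrightarrow> (\<exists>Y\<subseteq>D. indep Y \<and> X = f ` Y)" for X
  interpret M: matroid "f ` D" indep'
    unfolding indep'_def using matroid_restrict_image[OF f DE] .
  have card_f: "card (f ` Y) = card Y" if "Y \<subseteq> D" for Y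
    using f that by (meson card_image inj_on_subset)
  have CD: "C j \<subseteq> D" if "j \<in> {1..3}" for j using that unfolding D_def by auto
  have indep'_C: "indep' (f ` C j)" if "j \<in> {1..3}" for j
    using that C(1) CD unfolding indep'_def basis_def by blast
  have card_C: "card (C j) = rank" if "j \<in> {1..3}" for j
    using C(1)[OF that] basis_iff_card by simp
  \<comment> \<open>Restriction cannot raise the rank, and \<open>C 1\<close>, a basis inside
    \<open>D\<close>, keeps it from dropping.\<close>
  have "M.rank = rank"
  proof (rule antisym)
    obtain X where "indep' X" "card X = M.rank" using M.indep_card_eq_rank by auto
    then obtain Y where "Y \<subseteq> D" "indep Y" "X = f ` Y" unfolding indep'_def by auto
    then show "M.rank \<le> rank"
      using \<open>card X = M.rank\<close> card_f indep_card_le_rank by metis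
    show "rank \<le> M.rank"
      using M.indep_card_le_rank[OF indep'_C[of 1]] card_f[OF CD[of 1]] card_C[of 1] by simp
  qed
  have basis': "M.basis (f ` Y) \<longleftrightarrow> basis Y" if Y: "Y \<subseteq> D" for Y
  proof -
    have "indep' (f ` Y) \<longleftrightarrow> indep Y"
      unfolding indep'_def using Y f by (metis inj_on_image_eq_iff)
    then show ?thesis
      using M.basis_iff_card basis_iff_card \<open>M.rank = rank\<close> card_f[OF Y] by simp
  qed
  have disj': "disjoint_family_on (\<lambda>j. f ` S j) K"
    if "disjoint_family_on S K" "\<And>j. j \<in> K \<Longrightarrow> S j \<subseteq> D" for S :: "nat \<Rightarrow> 'a set" and K
    unfolding disjoint_family_on_def
  proof (intro ballI impI)
    fix m n assume mn: "m \<in> K" "n \<in> K" "m \<noteq> n"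
    have "f ` S m \<inter> f ` S n = f ` (S m \<inter> S n)"
      using inj_on_image_Int[OF f] that(2) mn by metis
    then show "f ` S m \<inter> f ` S n = {}"
      using that(1) mn unfolding disjoint_family_on_def by auto
  qed
  have "card D = (\<Sum>j\<in>{1..3}. card (C j))"
    unfolding D_def using C indep_finite unfolding basis_def disjoint_family_on_def
    by (intro card_UN_disjoint) auto
  also have "\<dots> = 3 * rank" using card_C by simp
  finally have "card (f ` D) = 3 * rank" using card_f by simp
  moreover have "\<exists>B. (\<forall>j\<in>{1..3}. M.basis (B j)) \<and> disjoint_family_on B {1..3} \<and>
      (\<Union>j\<in>{1..3::nat}. B j) = f ` D"
    using C basis' CD disj'[OF C(2) CD] unfolding D_def
    by (intro exI[of _ "\<lambda>j. f ` C j"]) (auto simp: image_UN)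
  moreover have "\<forall>i\<in>{1..rank}. indep' (f ` I i) \<and> card (f ` I i) \<le> 3"
    using I(1) card_f unfolding indep'_def D_def by metis
  moreover have "disjoint_family_on (\<lambda>i. f ` I i) {1..rank}"
    using disj'[OF I(2)] I(1) D_def by blast
  ultimately obtain G where G: "is_grid rank 3 (f ` D) G"
    "\<And>i. i \<in> {1..rank} \<Longrightarrow> f ` I i \<subseteq> grid_row 3 G i"
    "\<And>j. j \<in> {1..3} \<Longrightarrow> M.basis (grid_col rank G j)"
    using A[unfolded three_bases_statement_def, rule_format, OF rank M.matroid_axioms
        \<open>M.rank = rank\<close>, of "\<lambda>i. f ` I i"] by auto
  define g where "g = inv_into D f"
  have g: "bij_betw g (f ` D) D"
    unfolding g_def by (simp add: bij_betw_inv_into f inj_on_imp_bij_betw)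
  have gf: "g ` f ` Y = Y" if "Y \<subseteq> D" for Y
    using f that unfolding g_def by simp
  show thesis
  proof (rule that[of "g \<circ> G"])
    show "is_grid rank 3 (\<Union>j\<in>{1..3}. C j) (g \<circ> G)"
      using G(1) g bij_betw_trans unfolding is_grid_def D_def by blast
    show "I i \<subseteq> grid_row 3 (g \<circ> G) i" if "i \<in> {1..rank}" for i
    proof -
      have "g ` f ` I i \<subseteq> g ` grid_row 3 G i" using G(2)[OF that] by (rule image_mono)
      then show ?thesis using gf[of "I i"] I(1)[OF that]
        unfolding grid_row_def D_def by (simp add: image_comp)
    qed
    show "basis (grid_col rank (g \<circ> G) j)" if j: "j \<in> {1..3}" for j
    proof -
      have b: "M.basis (grid_col rank G j)" using G(3)[OF j] .
      \<comment> \<open>A column is independent after relabelling, hence the image of some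
        \<open>Y\<close> inside \<open>D\<close>, and \<open>g\<close> recovers this
        \<open>Y\<close>.\<close>
      then obtain Y where Y: "Y \<subseteq> D" "grid_col rank G j = f ` Y"
        unfolding M.basis_def indep'_def by auto
      then have "grid_col rank (g \<circ> G) j = Y"
        using gf[of Y] unfolding grid_col_def by (simp only: image_comp[symmetric])
      then show ?thesis using b basis' Y by simp
    qed
  qed
qed

section \<open>Replacing three columns by better ones\<close>

text \<open>Elements placed in the same row of the grid lie in different columns. So if (A) puts
  part of \<open>I i\<close> into row \<open>i\<close>, then \<open>I i\<close> meets at least that
  many of the new columns.\<close>

lemma recolumn_three:
  fixes C I :: "nat \<Rightarrow> 'a set"
  assumes A: "three_bases_statement TYPE(nat)"
    and rank: "rank \<ge> 1"
    and C: "\<And>j. j \<in> {1..3} \<Longrightarrow> basis (C j)" "disjoint_family_on C {1..3}"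
    and I: "\<And>i. i \<in> {1..rank} \<Longrightarrow> indep (I i)" "disjoint_family_on I {1..rank}"
  obtains D where "\<And>j. j \<in> {1..3} \<Longrightarrow> basis (D j)" "disjoint_family_on D {1..3}"
    "(\<Union>j\<in>{1..3::nat}. D j) = (\<Union>j\<in>{1..3}. C j)"
    "\<And>i. i \<in> {1..rank} \<Longrightarrow>
      min 3 (card (I i \<inter> (\<Union>j\<in>{1..3}. C j))) \<le> card {j \<in> {1..3}. D j \<inter> I i \<noteq> {}}"
proof -
  define U where "U = (\<Union>j\<in>{1..3}. C j)"
  \<comment> \<open>Statement (A) allows at most three prescribed elements per row, so
    \<open>I i \<inter> U\<close> is cut down to that size but no further.\<close>
  have "\<exists>J. J \<subseteq> I i \<inter> U \<and> card J = min 3 (card (I i \<inter> U))" for i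
    by (metis min.cobounded2 obtain_subset_with_card_n)
  then obtain J where J: "\<And>i. J i \<subseteq> I i \<inter> U" "\<And>i. card (J i) = min 3 (card (I i \<inter> U))"
    by metis
  have JI: "indep (J i) \<and> card (J i) \<le> 3 \<and> J i \<subseteq> (\<Union>j\<in>{1..3}. C j)" if "i \<in> {1..rank}" for i
    using J[of i] I(1)[OF that] indep_subset unfolding U_def by auto
  have disj_J: "disjoint_family_on J {1..rank}"
    using I(2) J(1) unfolding disjoint_family_on_def by blast
  obtain G where G: "is_grid rank 3 U G"
    "\<And>i. i \<in> {1..rank} \<Longrightarrow> J i \<subseteq> grid_row 3 G i"
    "\<And>j. j \<in> {1..3} \<Longrightarrow> basis (grid_col rank G j)"
    unfolding U_def using three_bases_grid[OF A rank C JI disj_J] by blast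
  have inj: "inj_on G ({1..rank} \<times> {1..3})" and im: "G ` ({1..rank} \<times> {1..3}) = U"
    using G(1) unfolding is_grid_def bij_betw_def by auto
  show thesis
  proof (rule that[of "grid_col rank G"])
    show "disjoint_family_on (grid_col rank G) {1..3}"
      unfolding disjoint_family_on_def grid_col_def
      using inj by (auto dest: inj_onD)
    have "(\<Union>j\<in>{1..3}. grid_col rank G j) = G ` ({1..rank} \<times> {1..3})"
      unfolding grid_col_def by blast
    then show "(\<Union>j\<in>{1..3}. grid_col rank G j) = (\<Union>j\<in>{1..3}. C j)"
      using im unfolding U_def by simp
    show "min 3 (card (I i \<inter> (\<Union>j\<in>{1..3}. C j)))
      \<le> card {j \<in> {1..3}. grid_col rank G j \<inter> I i \<noteq> {}}" if i: "i \<in> {1..rank}" for i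
    proof -
      let ?S = "{j \<in> {1..3}. grid_col rank G j \<inter> I i \<noteq> {}}"
      \<comment> \<open>Each element of \<open>J i\<close> is some \<open>G (i, j)\<close>, and it
        witnesses that column \<open>j\<close> meets \<open>I i\<close>.\<close>
      have "J i \<subseteq> (\<lambda>j. G (i, j)) ` ?S"
        using G(2)[OF i] J(1)[of i] i unfolding grid_row_def grid_col_def by fastforce
      then have "card (J i) \<le> card ?S"
        by (intro surj_card_le) auto
      then show ?thesis using J(2) unfolding U_def by simp
    qed
  qed (use G(3) in auto)
qed

text \<open>Three columns with union \<open>U\<close> can meet \<open>I i\<close> at most
  \<open>min 3 (card (I i \<inter> U))\<close> times, and the columns from
  \<open>recolumn_three\<close> reach this bound for all \<open>i\<close> at once, so no count
  drops. At \<open>i\<^sub>0\<close> the old columns stay below it, because \<open>l\<close> misses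
  \<open>I i\<^sub>0\<close> and \<open>j\<close> holds two of its elements. The column
  \<open>m\<close> only brings the number of columns to three.\<close>

lemma more_incidences:
  fixes C I :: "nat \<Rightarrow> 'a set"
  assumes A: "three_bases_statement TYPE(nat)"
    and K: "finite K" and C: "\<And>q. q \<in> K \<Longrightarrow> basis (C q)" "disjoint_family_on C K"
    and I: "\<And>i. i \<in> {1..rank} \<Longrightarrow> indep (I i)" "disjoint_family_on I {1..rank}"
    and jlm: "j \<in> K" "l \<in> K" "m \<in> K" "j \<noteq> l" "j \<noteq> m" "l \<noteq> m"
    and i\<^sub>0: "i\<^sub>0 \<in> {1..rank}" "C l \<inter> I i\<^sub>0 = {}" "2 \<le> card (C j \<inter> I i\<^sub>0)"
  obtains C' where "\<And>q. q \<in> K \<Longrightarrow> basis (C' q)" "disjoint_family_on C' K"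
    "(\<Union>q\<in>K. C' q) = (\<Union>q\<in>K. C q)"
    "(\<Sum>i\<in>{1..rank}. card {q \<in> K. C q \<inter> I i \<noteq> {}})
      < (\<Sum>i\<in>{1..rank}. card {q \<in> K. C' q \<inter> I i \<noteq> {}})"
proof -
  have three: "{1..3::nat} = {1,2,3}" by auto
  \<comment> \<open>\<open>P\<close> numbers the chosen columns by 1, 2, 3, the column indices used
    in (A).\<close>
  define P where "P = (\<lambda>q::nat. if q = 1 then j else if q = 2 then l else m)"
  have P: "P ` {1..3} = {j,l,m}" "inj_on P {1..3}"
    unfolding three P_def using jlm by (auto simp: inj_on_def)
  have CP: "\<And>q. q \<in> {1..3} \<Longrightarrow> basis ((C \<circ> P) q)" using C jlm unfolding P_def by simp
  have disj_CP: "disjoint_family_on (C \<circ> P) {1..3}"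
    using C(2) jlm unfolding three P_def disjoint_family_on_def by auto
  have U: "(\<Union>q\<in>{1..3}. (C \<circ> P) q) = C j \<union> C l \<union> C m"
    unfolding three P_def by auto
  have rank: "rank \<ge> 1" using i\<^sub>0(1) by simp
  obtain D where D: "\<And>q. q \<in> {1..3} \<Longrightarrow> basis (D q)" "disjoint_family_on D {1..3}"
    "(\<Union>q\<in>{1..3::nat}. D q) = C j \<union> C l \<union> C m"
    "\<And>i. i \<in> {1..rank} \<Longrightarrow>
      min 3 (card (I i \<inter> (C j \<union> C l \<union> C m))) \<le> card {q \<in> {1..3}. D q \<inter> I i \<noteq> {}}"
    using recolumn_three[OF A rank CP disj_CP I, unfolded U] by blast
  define C' where "C' = C(j := D 1, l := D 2, m := D 3)"
  have C'_P: "C' (P q) = D q" if "q \<in> {1..3}" for q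
    using that jlm unfolding three C'_def P_def by auto
  have basis': "basis (C' q)" if "q \<in> K" for q
    unfolding C'_def using that C(1) D(1) by auto
  have UD: "D 1 \<union> D 2 \<union> D 3 = C j \<union> C l \<union> C m"
    using D(3) unfolding three by auto
  have rest: "C' q = C q" if "q \<notin> {j,l,m}" for q
    using that unfolding C'_def by auto
  have Un': "C' j \<union> C' l \<union> C' m = C j \<union> C l \<union> C m"
    using UD jlm unfolding C'_def by auto
  have disj_C: "C p \<inter> C q = {}" if "p \<in> K" "q \<in> K" "p \<noteq> q" for p q
    using C(2) that unfolding disjoint_family_on_def by auto
  have inside: "C' p \<inter> C' q = {}" if pq: "p \<in> {j,l,m}" "q \<in> {j,l,m}" "p \<noteq> q" for p q
  proof -
    obtain p' where p': "p = P p'" "p' \<in> {1..3}" using pq(1) unfolding P(1)[symmetric] by blast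
    obtain q' where q': "q = P q'" "q' \<in> {1..3}" using pq(2) unfolding P(1)[symmetric] by blast
    have "p' \<noteq> q'" using p' q' pq(3) by auto
    then have "D p' \<inter> D q' = {}" by (rule disjoint_family_onD[OF D(2) p'(2) q'(2)])
    then show ?thesis using p' q' C'_P by simp
  qed
  \<comment> \<open>The three new columns have the same union as the old ones, so they stay disjoint
    from every untouched column.\<close>
  have cross: "C' p \<inter> C' q = {}" if "p \<in> {j,l,m}" "q \<in> K - {j,l,m}" for p q
  proof -
    have "C' p \<subseteq> C j \<union> C l \<union> C m" using that(1) Un' by auto
    moreover have "(C j \<union> C l \<union> C m) \<inter> C q = {}"
      using disj_C[of j q] disj_C[of l q] disj_C[of m q] that jlm by auto
    ultimately show ?thesis using rest that(2) by auto
  qed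
  have disj': "disjoint_family_on C' K"
    unfolding disjoint_family_on_def
  proof (intro ballI impI)
    fix p q assume pq: "p \<in> K" "q \<in> K" "p \<noteq> q"
    show "C' p \<inter> C' q = {}"
    proof (cases "p \<in> {j,l,m}"; cases "q \<in> {j,l,m}")
      assume "p \<notin> {j,l,m}" "q \<in> {j,l,m}"
      then show ?thesis using cross[of q p] pq by blast
    qed (use pq inside cross[of p q] rest disj_C in auto)
  qed
  have split: "(\<Union>q\<in>K. F q) = F j \<union> F l \<union> F m \<union> (\<Union>q\<in>K - {j,l,m}. F q)" for F :: "nat \<Rightarrow> 'a set"
    using jlm by auto
  have "(\<Union>q\<in>K - {j,l,m}. C' q) = (\<Union>q\<in>K - {j,l,m}. C q)" using rest by auto
  then have union': "(\<Union>q\<in>K. C' q) = (\<Union>q\<in>K. C q)"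
    using split[of C'] split[of C] Un' by simp
  \<comment> \<open>\<open>t F i\<close> counts only among the three chosen columns. The other
    columns do not change, so the two sums differ only through \<open>t\<close>.\<close>
  define t where "t F i = card {q \<in> {j,l,m}. F q \<inter> I i \<noteq> {}}" for F i
  have count: "card {q \<in> K. F q \<inter> I i \<noteq> {}}
      = t F i + card {q \<in> K - {j,l,m}. F q \<inter> I i \<noteq> {}}" for F i
  proof -
    have "{q \<in> K. F q \<inter> I i \<noteq> {}}
        = {q \<in> {j,l,m}. F q \<inter> I i \<noteq> {}} \<union> {q \<in> K - {j,l,m}. F q \<inter> I i \<noteq> {}}"
      using jlm by blast
    also have "card \<dots> = t F i + card {q \<in> K - {j,l,m}. F q \<inter> I i \<noteq> {}}"
      unfolding t_def using K by (intro card_Un_disjoint) auto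
    finally show ?thesis .
  qed
  have t': "min 3 (card (I i \<inter> (C j \<union> C l \<union> C m))) \<le> t C' i" if "i \<in> {1..rank}" for i
  proof -
    have "{q \<in> {j,l,m}. C' q \<inter> I i \<noteq> {}} = P ` {q \<in> {1..3}. D q \<inter> I i \<noteq> {}}"
    proof -
      have "{q \<in> P ` {1..3}. C' q \<inter> I i \<noteq> {}} = P ` {q \<in> {1..3}. C' (P q) \<inter> I i \<noteq> {}}"
        by blast
      also have "{q \<in> {1..3}. C' (P q) \<inter> I i \<noteq> {}} = {q \<in> {1..3}. D q \<inter> I i \<noteq> {}}"
        using C'_P by auto
      finally show ?thesis unfolding P(1) .
    qed
    moreover have "card (P ` {q \<in> {1..3}. D q \<inter> I i \<noteq> {}})
        = card {q \<in> {1..3}. D q \<inter> I i \<noteq> {}}"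
      by (intro card_image inj_on_subset[OF P(2)]) blast
    ultimately have "t C' i = card {q \<in> {1..3}. D q \<inter> I i \<noteq> {}}"
      unfolding t_def by (simp only:)
    then show ?thesis using D(4)[OF that] by simp
  qed
  have t3: "t C i \<le> 3" for i
  proof -
    have "t C i \<le> card {j,l,m}" unfolding t_def by (intro card_mono) auto
    then show ?thesis using jlm by simp
  qed
  have fin: "finite (C q \<inter> I i)" if "i \<in> {1..rank}" for q i
    using I(1)[OF that] indep_finite by blast
  \<comment> \<open>As a sum of indicators, \<open>t C i\<close> can be compared column by column
    with the sizes in \<open>card_sum\<close>.\<close>
  have t_sum: "t C i = (\<Sum>q\<in>{j,l,m}. if C q \<inter> I i \<noteq> {} then 1 else 0)" for i
    unfolding t_def by (simp only: card_eq_sum sum.inter_filter finite.intros)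
  have card_sum: "card (I i \<inter> (C j \<union> C l \<union> C m)) = (\<Sum>q\<in>{j,l,m}. card (C q \<inter> I i))"
    if "i \<in> {1..rank}" for i
  proof -
    have "I i \<inter> (C j \<union> C l \<union> C m) = (\<Union>q\<in>{j,l,m}. C q \<inter> I i)" by auto
    also have "card \<dots> = (\<Sum>q\<in>{j,l,m}. card (C q \<inter> I i))"
      using fin[OF that] disj_C jlm by (intro card_UN_disjoint) blast+
    finally show ?thesis .
  qed
  have one: "(if C q \<inter> I i \<noteq> {} then 1 else 0) \<le> card (C q \<inter> I i)" if "i \<in> {1..rank}" for q i
    using fin[OF that, of q] by (simp add: Suc_le_eq card_gt_0_iff)
  have le: "t C i \<le> t C' i" if "i \<in> {1..rank}" for i
  proof -
    have "t C i \<le> card (I i \<inter> (C j \<union> C l \<union> C m))"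
      unfolding card_sum[OF that] t_sum by (intro sum_mono one that)
    then show ?thesis using t'[OF that] t3[of i] by simp
  qed
  have less: "t C i\<^sub>0 < t C' i\<^sub>0"
  proof -
    \<comment> \<open>Column \<open>l\<close> contributes 0, so \<open>t\<close> is below 3; column
      \<open>j\<close> contributes 1 to \<open>t\<close> but at least 2 to the cardinality. Both
      arguments of the minimum in \<open>t'\<close> are therefore larger than the old count.\<close>
    have "C j \<inter> I i\<^sub>0 \<noteq> {}" using i\<^sub>0(3) by auto
    then have "t C i\<^sub>0 < card (I i\<^sub>0 \<inter> (C j \<union> C l \<union> C m))" "t C i\<^sub>0 < 3"
      unfolding card_sum[OF i\<^sub>0(1)] t_sum using jlm i\<^sub>0 one[OF i\<^sub>0(1), of m]
      by (simp_all split: if_splits)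
    then show ?thesis using t'[OF i\<^sub>0(1)] by auto
  qed
  have same: "{q \<in> K - {j,l,m}. C' q \<inter> I i \<noteq> {}} = {q \<in> K - {j,l,m}. C q \<inter> I i \<noteq> {}}" for i
    using rest by auto
  show thesis
  proof (rule that[OF basis' disj' union'])
    show "(\<Sum>i\<in>{1..rank}. card {q \<in> K. C q \<inter> I i \<noteq> {}})
      < (\<Sum>i\<in>{1..rank}. card {q \<in> K. C' q \<inter> I i \<noteq> {}})"
      unfolding count same using le less i\<^sub>0(1)
      by (intro sum_strict_mono_ex1) auto
  qed
qed

section \<open>The maximality argument for rank at least three\<close>

lemma partition_meeting_all:
  fixes B :: "nat \<Rightarrow> 'a set"
  assumes A: "three_bases_statement TYPE(nat)"
    and rank: "rank \<ge> 3"
    and B: "\<And>i. i \<in> {1..rank} \<Longrightarrow> basis (B i)" "disjoint_family_on B {1..rank}"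
  obtains C where "\<And>j. j \<in> {1..rank} \<Longrightarrow> basis (C j)" "disjoint_family_on C {1..rank}"
    "\<And>i j. i \<in> {1..rank} \<Longrightarrow> j \<in> {1..rank} \<Longrightarrow> C j \<inter> B i \<noteq> {}"
proof -
  let ?K = "{1..rank}"
  define admissible where "admissible C \<longleftrightarrow> (\<forall>j\<in>?K. basis (C j)) \<and> disjoint_family_on C ?K \<and>
    (\<Union>j\<in>?K. C j) = (\<Union>i\<in>?K. B i)" for C
  define \<phi> where "\<phi> C = (\<Sum>i\<in>?K. card {q \<in> ?K. C q \<inter> B i \<noteq> {}})" for C
  \<comment> \<open>\<open>admissible\<close> leaves the values of \<open>C\<close> outside
    \<open>?K\<close> free, so a maximizer is obtained from a uniform bound on \<phi> and not from
    finiteness of the set of candidates.\<close>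
  have "\<phi> C < Suc (rank * rank)" for C
  proof -
    have "\<phi> C \<le> (\<Sum>i\<in>?K. rank)"
      unfolding \<phi>_def
    proof (rule sum_mono)
      fix i
      have "card {q \<in> ?K. C q \<inter> B i \<noteq> {}} \<le> card ?K" by (intro card_mono) auto
      then show "card {q \<in> ?K. C q \<inter> B i \<noteq> {}} \<le> rank" by simp
    qed
    then show ?thesis by simp
  qed
  moreover have "admissible B" unfolding admissible_def using B by auto
  ultimately obtain C where C: "admissible C" and max: "\<And>D. admissible D \<Longrightarrow> \<phi> D \<le> \<phi> C"
    using ex_has_greatest_nat[of admissible B \<phi>] by metis
  have C': "\<And>j. j \<in> ?K \<Longrightarrow> basis (C j)" "disjoint_family_on C ?K"
    "(\<Union>j\<in>?K. C j) = (\<Union>i\<in>?K. B i)"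
    using C unfolding admissible_def by auto
  have indep_B: "indep (B i)" if "i \<in> ?K" for i using B(1)[OF that] unfolding basis_def by simp
  have "C l \<inter> B i \<noteq> {}" if i: "i \<in> ?K" and l: "l \<in> ?K" for i l
  proof
    assume empty: "C l \<inter> B i = {}"
    \<comment> \<open>Pigeonhole: the \<open>rank\<close> elements of \<open>B i\<close> are spread
      over the \<open>rank - 1\<close> columns other than \<open>l\<close>, so some column
      \<open>j\<close> receives two.\<close>
    have "B i = (\<Union>q\<in>?K - {l}. C q \<inter> B i)"
      using C'(3) i empty by fastforce
    then have "card (B i) \<le> (\<Sum>q\<in>?K - {l}. card (C q \<inter> B i))"
      by (metis card_UN_le finite_Diff finite_atLeastAtMost)
    moreover have "card (B i) = rank" using B(1)[OF i] basis_iff_card by simp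
    moreover have "(\<Sum>q\<in>?K - {l}. card (C q \<inter> B i)) \<le> rank - 1"
      if "\<forall>q\<in>?K - {l}. card (C q \<inter> B i) \<le> 1"
      using sum_bounded_above[of "?K - {l}" "\<lambda>q. card (C q \<inter> B i)" 1] that l by simp
    ultimately obtain j where j: "j \<in> ?K - {l}" "2 \<le> card (C j \<inter> B i)"
      using rank by fastforce
    \<comment> \<open>Here rank at least three enters: it supplies the third column that (A)
      requires.\<close>
    have "\<exists>m\<in>?K. m \<noteq> j \<and> m \<noteq> l"
    proof -
      have "card {j, l} < card ?K" using rank card_insert_le_m1[of 2 "{l}" j] by simp
      then have "\<not> ?K \<subseteq> {j, l}" by (metis card_mono finite.emptyI finite.insertI not_le)
      then show ?thesis by auto
    qed
    then obtain m where "m \<in> ?K" "m \<noteq> j" "m \<noteq> l" by auto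
    then obtain D where "\<And>q. q \<in> ?K \<Longrightarrow> basis (D q)" "disjoint_family_on D ?K"
      "(\<Union>q\<in>?K. D q) = (\<Union>q\<in>?K. C q)" "\<phi> C < \<phi> D"
      unfolding \<phi>_def
      using more_incidences[OF A finite_atLeastAtMost C'(1,2) indep_B B(2), of j l m i]
        j i l empty by blast
    then have "admissible D" "\<phi> C < \<phi> D" unfolding admissible_def using C'(3) by auto
    then show False using max by (meson not_le)
  qed
  then show thesis using that[OF C'(1,2)] by simp
qed

section \<open>Rank two\<close>

lemma rank_two_partition_meeting_all:
  assumes B: "basis B\<^sub>1" "basis B\<^sub>2" "B\<^sub>1 \<inter> B\<^sub>2 = {}" and rank: "rank = 2"
  obtains X Y where "basis X" "basis Y" "X \<inter> Y = {}"
    "X \<inter> B\<^sub>1 \<noteq> {}" "X \<inter> B\<^sub>2 \<noteq> {}" "Y \<inter> B\<^sub>1 \<noteq> {}" "Y \<inter> B\<^sub>2 \<noteq> {}"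
proof -
  \<comment> \<open>Augmenting \<open>{x}\<close> from \<open>{u, v}\<close> cannot add
    \<open>u\<close>, so it adds \<open>v\<close>; likewise augmenting \<open>{u}\<close> from
    \<open>{x, y}\<close> must add \<open>y\<close>.\<close>
  have exchange: "indep {x, v} \<and> indep {u, y}"
    if "indep {x, y}" "indep {u, v}" "x \<noteq> y" "u \<noteq> v" "\<not> indep {x, u}" for x y u v
  proof -
    have "indep {x}" "indep {u}" using that(1,2) indep_subset by blast+
    then show ?thesis
      using that augmentation[of "{x}" "{u, v}"] augmentation[of "{u}" "{x, y}"]
      by (auto simp: insert_commute)
  qed
  obtain a b where ab: "B\<^sub>1 = {a, b}" "a \<noteq> b"
    using B(1) rank basis_iff_card by (auto simp: card_2_iff)
  obtain c d where cd: "B\<^sub>2 = {c, d}" "c \<noteq> d"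
    using B(2) rank basis_iff_card by (auto simp: card_2_iff)
  have i: "indep {a, b}" "indep {b, a}" "indep {c, d}" "indep {d, c}"
    using B ab cd unfolding basis_def by (auto simp: insert_commute)
  have ne: "a \<noteq> c" "a \<noteq> d" "b \<noteq> c" "b \<noteq> d" using B(3) ab cd by auto
  show thesis
  proof (cases "indep {a, c} \<and> indep {b, d}")
    case True
    then show ?thesis
      using that[of "{a, c}" "{b, d}"] ab cd ne rank by (auto simp: basis_iff_card)
  next
    case False
    \<comment> \<open>Whichever of \<open>{a, c}\<close> and \<open>{b, d}\<close> is dependent,
      exchange yields the same other pairing.\<close>
    then have "indep {a, d} \<and> indep {b, c}"
      using exchange[of a b c d] exchange[of b a d c] i ab cd by (auto simp: insert_commute)
    then show ?thesis
      using that[of "{a, d}" "{b, c}"] ab cd ne rank by (auto simp: basis_iff_card)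
  qed
qed

end

section \<open>Reading off the grid from prescribed rows and columns\<close>

text \<open>A cell receives an element common to its row set and its column set. Disjointness within
  both families makes this injective; counting then gives all of \<open>E\<close>, and turns each
  inclusion of a row or column into an equality.\<close>

lemma grid_of_meeting_partitions:
  fixes B C :: "nat \<Rightarrow> 'a set"
  assumes E: "finite E" "card E = n ^ 2"
    and B: "\<And>i. i \<in> {1..n} \<Longrightarrow> card (B i) = n \<and> B i \<subseteq> E" "disjoint_family_on B {1..n}"
    and C: "\<And>j. j \<in> {1..n} \<Longrightarrow> card (C j) = n \<and> C j \<subseteq> E" "disjoint_family_on C {1..n}"
    and meet: "\<And>i j. i \<in> {1..n} \<Longrightarrow> j \<in> {1..n} \<Longrightarrow> C j \<inter> B i \<noteq> {}"
  obtains G where "is_grid n n E G"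
    "\<And>i. i \<in> {1..n} \<Longrightarrow> grid_row n G i = B i" "\<And>j. j \<in> {1..n} \<Longrightarrow> grid_col n G j = C j"
proof -
  define G where "G = (\<lambda>(i, j). SOME x. x \<in> C j \<inter> B i)"
  have G: "G (i, j) \<in> C j" "G (i, j) \<in> B i" if "i \<in> {1..n}" "j \<in> {1..n}" for i j
    using someI_ex[of "\<lambda>x. x \<in> C j \<inter> B i"] meet[OF that] unfolding G_def by auto
  have inj: "inj_on G ({1..n} \<times> {1..n})"
  proof (rule inj_onI, clarify)
    fix i j i' j'
    assume *: "i \<in> {1..n}" "j \<in> {1..n}" "i' \<in> {1..n}" "j' \<in> {1..n}" "G (i, j) = G (i', j')"
    then have "G (i, j) \<in> C j \<inter> C j'" "G (i, j) \<in> B i \<inter> B i'"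
      using G by (metis IntI)+
    then have "C j \<inter> C j' \<noteq> {}" "B i \<inter> B i' \<noteq> {}" by auto
    then show "i = i' \<and> j = j'" using B(2) C(2) *(1-4) unfolding disjoint_family_on_def by metis
  qed
  have card_G: "card (G ` S) = card S" if "S \<subseteq> {1..n} \<times> {1..n}" for S
    using inj that by (meson card_image inj_on_subset)
  have fin: "finite (B i)" "finite (C i)" if "i \<in> {1..n}" for i
    using B(1)[OF that] C(1)[OF that] E finite_subset by blast+
  show thesis
  proof (rule that)
    have "G ` ({1..n} \<times> {1..n}) = E"
    proof (rule card_subset_eq[OF E(1)])
      show "G ` ({1..n} \<times> {1..n}) \<subseteq> E"
      proof clarify
        fix i j assume "i \<in> {1..n}" "j \<in> {1..n}"
        then show "G (i, j) \<in> E" using G(2)[of i j] B(1)[of i] by auto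
      qed
    qed (simp add: card_G E power2_eq_square)
    then show "is_grid n n E G" using inj unfolding is_grid_def bij_betw_def by simp
    show "grid_row n G i = B i" if i: "i \<in> {1..n}" for i
      unfolding grid_row_def
    proof (rule card_subset_eq[OF fin(1)[OF i]])
      have s: "{i} \<times> {1..n} \<subseteq> {1..n} \<times> {1..n}" using i by auto
      show "card (G ` ({i} \<times> {1..n})) = card (B i)"
        using B(1)[OF i] card_G[OF s] by (simp add: card_cartesian_product)
    qed (use G i in auto)
    show "grid_col n G j = C j" if j: "j \<in> {1..n}" for j
      unfolding grid_col_def
    proof (rule card_subset_eq[OF fin(2)[OF j]])
      have s: "{1..n} \<times> {j} \<subseteq> {1..n} \<times> {1..n}" using j by auto
      show "card (G ` ({1..n} \<times> {j})) = card (C j)"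
        using C(1)[OF j] card_G[OF s] by (simp add: card_cartesian_product)
    qed (use G j in auto)
  qed
qed

section \<open>Case distinction on the rank and assembly\<close>

theorem theorem3:
  assumes "three_bases_statement TYPE(nat)"
  shows "rota_basis_conjecture TYPE('a)"
  unfolding rota_basis_conjecture_def
proof (intro allI impI)
  fix n and E :: "'a set" and indep and B :: "nat \<Rightarrow> 'a set"
  assume n: "n \<ge> 1" and M: "matroid E indep" and r: "matroid.rank E indep = n"
    and E: "card E = n ^ 2" and "\<forall>i\<in>{1..n}. matroid.basis E indep (B i)"
    and disj: "disjoint_family_on B {1..n}"
  interpret matroid E indep by (rule M)
  have B: "\<And>i. i \<in> {1..n} \<Longrightarrow> basis (B i)"
    using \<open>\<forall>i\<in>{1..n}. matroid.basis E indep (B i)\<close> by simp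
  have "\<exists>C. (\<forall>j\<in>{1..n}. basis (C j)) \<and> disjoint_family_on C {1..n} \<and>
      (\<forall>i\<in>{1..n}. \<forall>j\<in>{1..n}. C j \<inter> B i \<noteq> {})"
  proof -
    consider "n = 1" | "n = 2" | "n \<ge> 3" using n by linarith
    then show ?thesis
    proof cases
      \<comment> \<open>The only column is the only basis, so it suffices that \<open>B 1\<close> is
        nonempty.\<close>
      case 1
      then have "B 1 \<noteq> {}" using B[of 1] r basis_iff_card by auto
      then show ?thesis using 1 B disj by (intro exI[of _ B]) auto
    next
      case 2
      have two: "{1..n} = {1, 2}" using 2 by auto
      have "basis (B 1)" "basis (B 2)" "B 1 \<inter> B 2 = {}" "rank = 2"
        using B disj r 2 unfolding two disjoint_family_on_def by auto
      then obtain X Y where XY: "basis X" "basis Y" "X \<inter> Y = {}"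
        "X \<inter> B 1 \<noteq> {}" "X \<inter> B 2 \<noteq> {}" "Y \<inter> B 1 \<noteq> {}" "Y \<inter> B 2 \<noteq> {}"
        by (rule rank_two_partition_meeting_all)
      then show ?thesis
        unfolding two disjoint_family_on_def
        by (intro exI[of _ "\<lambda>j. if j = 1 then X else Y"]) auto
    next
      case 3
      then have "rank \<ge> 3" using r by simp
      from partition_meeting_all[OF assms this, of B] B disj show ?thesis
        unfolding r by metis
    qed
  qed
  then obtain C where C: "\<And>j. j \<in> {1..n} \<Longrightarrow> basis (C j)" "disjoint_family_on C {1..n}"
    "\<And>i j. i \<in> {1..n} \<Longrightarrow> j \<in> {1..n} \<Longrightarrow> C j \<inter> B i \<noteq> {}" by blast
  have "card X = n \<and> X \<subseteq> E" if "basis X" for X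
    using that basis_iff_card basis_subset_ground r by simp
  then obtain G where "is_grid n n E G" "\<And>i. i \<in> {1..n} \<Longrightarrow> grid_row n G i = B i"
    "\<And>j. j \<in> {1..n} \<Longrightarrow> grid_col n G j = C j"
    using grid_of_meeting_partitions[OF finite_ground E _ disj _ C(2,3)] B C(1) by metis
  then show "\<exists>G. is_grid n n E G \<and> (\<forall>i\<in>{1..n}. B i \<subseteq> grid_row n G i) \<and>
      (\<forall>j\<in>{1..n}. basis (grid_col n G j))"
    using C(1) by (metis subset_refl)
qed

end
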